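(* Let $c,c'$ be well-formed GCL commands and $\mathcal{S},\mathcal{T}$ relations on stores. If $\models c\mid c':\langle\mathcal{S}\rangle\langle\mathcal{T}\rangle$, then $c\mid c':\langle\mathcal{S}\rangle\langle\mathcal{T}\rangle$ is derivable in RHL+.
   Context: Stores are total maps from integer variables to $\mathbb{Z}$. GCL commands: $c ::= \mathsf{skip}^n \mid x :=^n e \mid c;c \mid \mathsf{if}^n\, gcs\,\mathsf{fi} \mid \mathsf{do}^n\, gcs\,\mathsf{od}$, $gcs ::= e\to c \mid e\to c \,\square\, gcs$, with labels $n$ (semantically irrelevant), always-defined expressions, boolean expressions built from primitive ones with $\wedge,\vee,\neg$; $\mathsf{enab}(gcs)$ is the disjunction of guards. Well formed: well typed and each $\mathsf{if}^n gcs\,\mathsf{fi}$ subcommand has $\mathsf{enab}(gcs)$ true in every store. $[\![c]\!]$ is the standard big-step partial-correctness relation (if picks any enabled branch; do iterates enabled branches until $\mathsf{enab}(gcs)$ is false). $\models c\mid c':\langle\mathcal{R}\rangle\langle\mathcal{S}\rangle$ means: for all $(s,t)\in[\![c]\!]$ and $(s',t')\in[\![c']\!]$, $(s,s')\in\mathcal{R}$ implies $(t,t')\in\mathcal{S}$. Notation: $P^{\mathrm{L}}=\{(s,s'):s\in P\}$, $P^{\mathrm{R}}=\{(s,s'):s'\in P\}$ (a boolean expression $e$ denotes the set of stores where it is true); $(e^{\mathrm{L}}=e'^{\mathrm{R}})=\{(s,s'):[\![e]\!](s)=[\![e']\!](s')\}$; $(s,s')\in\mathcal{R}[x|x':=e|e']$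 iff $(s[x\mapsto[\![e]\!](s)],s'[x'\mapsto[\![e']\!](s')])\in\mathcal{R}$, with one-sided versions $\mathcal{R}[x|\,:=e|\,]$, $\mathcal{R}[\,|x:=\,|e]$; $\mathrm{indep}(x|x',\mathcal{R})$: membership unaffected by changing $x$ on the left and $x'$ on the right; $\mathsf{ghost}(x,c)$: $x$ occurs in $c$ only in assignments to $x$; $\mathsf{erase}(x,c)$: each assignment to $x$ replaced by skip. $c\cong d$ means $\mathrm{Hyp}\vdash\mathcal{K}(c)=\mathcal{K}(d)$ in Kleene algebra with tests, where $\mathcal{K}$ is the standard translation ($\mathcal{K}(\mathsf{skip})=1$, $\mathcal{K}(c;d)=\mathcal{K}(c);\mathcal{K}(d)$, $\mathcal{K}(\mathsf{if}\,gcs\,\mathsf{fi})=\sum_{e\to c\in gcs}\mathcal{K}(e);\mathcal{K}(c)$, $\mathcal{K}(\mathsf{do}\,gcs\,\mathsf{od})=(\sum_{e\to c\in gcs}\mathcal{K}(e);\mathcal{K}(c))^*;\neg\mathcal{K}(\mathsf{enab}(gcs))$, boolean connectives to test operations, primitive tests and assignments to atoms) and $\mathrm{Hyp}$ is the set of equations $\mathcal{K}(e)=0$ for every unsatisfiable boolean expression $e$ and $\mathcal{K}(e_0);\mathcal{K}(x:=e);\neg\mathcal{K}(e_1)=0$ whenever $e_0\Rightarrow e_1[x:=e]$ is valid. RHL+ rules: rRewrite (from $c\mid c':\langle\mathcal{R}\rangle\langle\mathcal{S}\rangle$, $c\cong d$, $c'\cong d'$ infer $d\mid d':\langle\mathcal{R}\rangle\langle\mathcal{S}\rangle$);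 rGhost (from $c\mid c':\langle\mathcal{R}\rangle\langle\mathcal{S}\rangle$, $\mathsf{ghost}(x,c)$, $\mathsf{ghost}(x',c')$, $\mathrm{indep}(x|x',\mathcal{R})$, $\mathrm{indep}(x|x',\mathcal{S})$ infer $\mathsf{erase}(x,c)\mid\mathsf{erase}(x',c'):\langle\mathcal{R}\rangle\langle\mathcal{S}\rangle$); dIf (from $c\mid c':\langle\mathcal{R}\wedge e^{\mathrm{L}}\wedge e'^{\mathrm{R}}\rangle\langle\mathcal{S}\rangle$ for all $e\to c\in gcs$, $e'\to c'\in gcs'$ infer $\mathsf{if}\,gcs\,\mathsf{fi}\mid\mathsf{if}\,gcs'\,\mathsf{fi}:\langle\mathcal{R}\rangle\langle\mathcal{S}\rangle$); dAsgn ($x:=e\mid x':=e':\langle\mathcal{R}[x|x':=e|e']\rangle\langle\mathcal{R}\rangle$); AsgnSkip ($x:=e\mid\mathsf{skip}:\langle\mathcal{R}[x|\,:=e|\,]\rangle\langle\mathcal{R}\rangle$); SkipAsgn ($\mathsf{skip}\mid x:=e:\langle\mathcal{R}[\,|x:=\,|e]\rangle\langle\mathcal{R}\rangle$); dSkip ($\mathsf{skip}\mid\mathsf{skip}:\langle\mathcal{R}\rangle\langle\mathcal{R}\rangle$); dSeq; dDo (for relations $\mathcal{Q},\Lambda,\mathcal{P}$: from $c\mid\mathsf{skip}:\langle\mathcal{Q}\wedge e^{\mathrm{L}}\wedge\Lambda\rangle\langle\mathcal{Q}\rangle$ for all $e\to c\in gcs$, $\mathsf{skip}\mid c':\langle\mathcal{Q}\wedge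 e'^{\mathrm{R}}\wedge\mathcal{P}\rangle\langle\mathcal{Q}\rangle$ for all $e'\to c'\in gcs'$, $c\mid c':\langle\mathcal{Q}\wedge e^{\mathrm{L}}\wedge e'^{\mathrm{R}}\wedge\neg\Lambda\wedge\neg\mathcal{P}\rangle\langle\mathcal{Q}\rangle$ for all pairs, and $\mathcal{Q}\subseteq(\mathsf{enab}(gcs)^{\mathrm{L}}=\mathsf{enab}(gcs')^{\mathrm{R}})\cup(\Lambda\cap\mathsf{enab}(gcs)^{\mathrm{L}})\cup(\mathcal{P}\cap\mathsf{enab}(gcs')^{\mathrm{R}})$, infer $\mathsf{do}\,gcs\,\mathsf{od}\mid\mathsf{do}\,gcs'\,\mathsf{od}:\langle\mathcal{Q}\rangle\langle\mathcal{Q}\wedge\neg\mathsf{enab}(gcs)^{\mathrm{L}}\wedge\neg\mathsf{enab}(gcs')^{\mathrm{R}}\rangle$); rConseq (entailment is inclusion); rDisj (from judgments with preconditions $\mathcal{Q}$ and $\mathcal{R}$ and common postcondition infer the one with precondition $\mathcal{Q}\vee\mathcal{R}$); rFalse ($c\mid d:\langle\mathrm{false}\rangle\langle\mathcal{R}\rangle$). *)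

theory Defs
  imports Main
begin

text \<open>
  The expression language is left open: the types \<open>'f\<close> and \<open>'p\<close> are arbitrary sets of operator
  symbols and of predicate symbols, and the two classes below supply a total interpretation, so
  that expressions are always defined.  Integer and boolean expressions are separate types, and
  all variables are integer variables; hence every command is well typed.
\<close>

class int_operator =
  fixes opr :: "'a \<Rightarrow> int list \<Rightarrow> int"

class int_predicate =
  fixes prd :: "'a \<Rightarrow> int list \<Rightarrow> bool"

type_synonym vname = string
type_synonym store = "vname \<Rightarrow> int"

datatype 'f iexp =
    Var vname
  | Op 'f "'f iexp list"

datatype ('f, 'p) bexp =
    Prim 'p "'f iexp list"
  | And "('f, 'p) bexp" "('f, 'p) bexp"
  | Or "('f, 'p) bexp" "('f, 'p) bexp"
  | Not "('f, 'p) bexp"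

primrec ival :: "'f::int_operator iexp \<Rightarrow> store \<Rightarrow> int" where
  "ival (Var x) s = s x"
| "ival (Op f es) s = opr f (map (\<lambda>e. ival e s) es)"

primrec bval :: "('f::int_operator, 'p::int_predicate) bexp \<Rightarrow> store \<Rightarrow> bool" where
  "bval (Prim p es) s = prd p (map (\<lambda>e. ival e s) es)"
| "bval (And a b) s = (bval a s \<and> bval b s)"
| "bval (Or a b) s = (bval a s \<or> bval b s)"
| "bval (Not a) s = (\<not> bval a s)"

primrec ivars :: "'f iexp \<Rightarrow> vname set" where
  "ivars (Var x) = {x}"
| "ivars (Op f es) = \<Union> (set (map ivars es))"

primrec bvars :: "('f, 'p) bexp \<Rightarrow> vname set" where
  "bvars (Prim p es) = \<Union> (set (map ivars es))"
| "bvars (And a b) = bvars a \<union> bvars b"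
| "bvars (Or a b) = bvars a \<union> bvars b"
| "bvars (Not a) = bvars a"

primrec isubst :: "vname \<Rightarrow> 'f iexp \<Rightarrow> 'f iexp \<Rightarrow> 'f iexp" where
  "isubst x d (Var y) = (if y = x then d else Var y)"
| "isubst x d (Op f es) = Op f (map (isubst x d) es)"

text \<open>\<open>bsubst x d b\<close> is \<open>b[x := d]\<close>.\<close>

primrec bsubst :: "vname \<Rightarrow> 'f iexp \<Rightarrow> ('f, 'p) bexp \<Rightarrow> ('f, 'p) bexp" where
  "bsubst x d (Prim p es) = Prim p (map (isubst x d) es)"
| "bsubst x d (And a b) = And (bsubst x d a) (bsubst x d b)"
| "bsubst x d (Or a b) = Or (bsubst x d a) (bsubst x d b)"
| "bsubst x d (Not a) = Not (bsubst x d a)"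


datatype
  ('f, 'p) com =
    Skip nat
  | Assign nat vname "'f iexp"
  | Seq "('f, 'p) com" "('f, 'p) com"
  | If nat "('f, 'p) gcs"
  | Do nat "('f, 'p) gcs"
and
  ('f, 'p) gcs =
    Guard "('f, 'p) bexp" "('f, 'p) com"
  | Alt "('f, 'p) bexp" "('f, 'p) com" "('f, 'p) gcs"

primrec branches :: "('f, 'p) gcs \<Rightarrow> (('f, 'p) bexp \<times> ('f, 'p) com) set" where
  "branches (Guard e c) = {(e, c)}"
| "branches (Alt e c g) = insert (e, c) (branches g)"

primrec enab :: "('f, 'p) gcs \<Rightarrow> ('f, 'p) bexp" where
  "enab (Guard e c) = e"
| "enab (Alt e c g) = Or e (enab g)"

primrec wf_com :: "('f::int_operator, 'p::int_predicate) com \<Rightarrow> bool"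
  and wf_gcs :: "('f, 'p) gcs \<Rightarrow> bool" where
  "wf_com (Skip n) = True"
| "wf_com (Assign n x e) = True"
| "wf_com (Seq c d) = (wf_com c \<and> wf_com d)"
| "wf_com (If n g) = (wf_gcs g \<and> (\<forall>s. bval (enab g) s))"
| "wf_com (Do n g) = wf_gcs g"
| "wf_gcs (Guard e c) = wf_com c"
| "wf_gcs (Alt e c g) = (wf_com c \<and> wf_gcs g)"

inductive exec :: "('f::int_operator, 'p::int_predicate) com \<Rightarrow> store \<Rightarrow> store \<Rightarrow> bool" where
  Skip: "exec (Skip n) s s"
| Assign: "exec (Assign n x e) s (s(x := ival e s))"
| Seq: "exec c s t \<Longrightarrow> exec d t u \<Longrightarrow> exec (Seq c d) s u"
| If: "(e, c) \<in> branches g \<Longrightarrow> bval e s \<Longrightarrow> exec c s t \<Longrightarrow> exec (If n g) s t"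
| Do_exit: "\<not> bval (enab g) s \<Longrightarrow> exec (Do n g) s s"
| Do_iter: "(e, c) \<in> branches g \<Longrightarrow> bval e s \<Longrightarrow> exec c s t \<Longrightarrow> exec (Do n g) t u
    \<Longrightarrow> exec (Do n g) s u"

definition den :: "('f::int_operator, 'p::int_predicate) com \<Rightarrow> (store \<times> store) set" where
  "den c = {(s, t). exec c s t}"

type_synonym strel = "(store \<times> store) set"

definition rvalid ::
  "('f::int_operator, 'p::int_predicate) com \<Rightarrow> ('f, 'p) com \<Rightarrow> strel \<Rightarrow> strel \<Rightarrow> bool" where
  "rvalid c c' R S \<longleftrightarrow>
    (\<forall>s t s' t'. (s, t) \<in> den c \<longrightarrow> (s', t') \<in> den c' \<longrightarrow> (s, s') \<in> R \<longrightarrow> (t, t') \<in> S)"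


definition bset :: "('f::int_operator, 'p::int_predicate) bexp \<Rightarrow> store set" where
  "bset e = {s. bval e s}"

definition lft :: "store set \<Rightarrow> strel" where
  "lft P = {(s, s'). s \<in> P}"

definition rgt :: "store set \<Rightarrow> strel" where
  "rgt P = {(s, s'). s' \<in> P}"

definition beq_lr ::
  "('f::int_operator, 'p::int_predicate) bexp \<Rightarrow> ('f, 'p) bexp \<Rightarrow> strel" where
  "beq_lr e e' = {(s, s'). bval e s = bval e' s'}"

definition subst_lr ::
  "vname \<Rightarrow> vname \<Rightarrow> 'f::int_operator iexp \<Rightarrow> 'f iexp \<Rightarrow> strel \<Rightarrow> strel" where
  "subst_lr x x' e e' R = {(s, s'). (s(x := ival e s), s'(x' := ival e' s')) \<in> R}"

definition subst_l :: "vname \<Rightarrow> 'f::int_operator iexp \<Rightarrow> strel \<Rightarrow> strel" where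
  "subst_l x e R = {(s, s'). (s(x := ival e s), s') \<in> R}"

definition subst_r :: "vname \<Rightarrow> 'f::int_operator iexp \<Rightarrow> strel \<Rightarrow> strel" where
  "subst_r x e R = {(s, s'). (s, s'(x := ival e s')) \<in> R}"

definition indep :: "vname \<Rightarrow> vname \<Rightarrow> strel \<Rightarrow> bool" where
  "indep x x' R \<longleftrightarrow> (\<forall>s s' i i'. (s(x := i), s'(x' := i')) \<in> R \<longleftrightarrow> (s, s') \<in> R)"

text \<open>An assignment to the ghost variable may itself read the ghost variable.\<close>

primrec ghost :: "vname \<Rightarrow> ('f, 'p) com \<Rightarrow> bool"
  and ghost_gcs :: "vname \<Rightarrow> ('f, 'p) gcs \<Rightarrow> bool" where
  "ghost x (Skip n) = True"
| "ghost x (Assign n y e) = (y = x \<or> x \<notin> ivars e)"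
| "ghost x (Seq c d) = (ghost x c \<and> ghost x d)"
| "ghost x (If n g) = ghost_gcs x g"
| "ghost x (Do n g) = ghost_gcs x g"
| "ghost_gcs x (Guard e c) = (x \<notin> bvars e \<and> ghost x c)"
| "ghost_gcs x (Alt e c g) = (x \<notin> bvars e \<and> ghost x c \<and> ghost_gcs x g)"

primrec erase :: "vname \<Rightarrow> ('f, 'p) com \<Rightarrow> ('f, 'p) com"
  and erase_gcs :: "vname \<Rightarrow> ('f, 'p) gcs \<Rightarrow> ('f, 'p) gcs" where
  "erase x (Skip n) = Skip n"
| "erase x (Assign n y e) = (if y = x then Skip n else Assign n y e)"
| "erase x (Seq c d) = Seq (erase x c) (erase x d)"
| "erase x (If n g) = If n (erase_gcs x g)"
| "erase x (Do n g) = Do n (erase_gcs x g)"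
| "erase_gcs x (Guard e c) = Guard e (erase x c)"
| "erase_gcs x (Alt e c g) = Alt e (erase x c) (erase_gcs x g)"


text \<open>
  Tests and programs share \<open>0\<close>, \<open>1\<close>, sum and product, so there is a single type of terms over
  atomic tests \<open>'t\<close> and atomic programs \<open>'a\<close>.  Complement is only meaningful on the terms that
  satisfy \<open>is_test\<close>: no axiom below speaks about the complement of any other term.
\<close>

datatype ('t, 'a) kat =
    KZero
  | KOne
  | KTest 't
  | KAct 'a
  | KNot "('t, 'a) kat"
  | KPlus "('t, 'a) kat" "('t, 'a) kat"
  | KTimes "('t, 'a) kat" "('t, 'a) kat"
  | KStar "('t, 'a) kat"

primrec is_test :: "('t, 'a) kat \<Rightarrow> bool" where
  "is_test KZero = True"
| "is_test KOne = True"
| "is_test (KTest b) = True"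
| "is_test (KAct a) = False"
| "is_test (KNot p) = is_test p"
| "is_test (KPlus p q) = (is_test p \<and> is_test q)"
| "is_test (KTimes p q) = (is_test p \<and> is_test q)"
| "is_test (KStar p) = False"

text \<open>
  \<open>kat_eq H p q\<close>: the equation \<open>p = q\<close> follows from the equations in \<open>H\<close> by Kozen's axioms for
  Kleene algebra with tests and Horn-equational reasoning.  Here \<open>p \<le> q\<close> is rendered as
  \<open>p + q = q\<close>.  The four test rules are those of Huntington's postulates for Boolean algebras
  which are not already instances of the semiring axioms.
\<close>

inductive kat_eq ::
  "(('t, 'a) kat \<times> ('t, 'a) kat) set \<Rightarrow> ('t, 'a) kat \<Rightarrow> ('t, 'a) kat \<Rightarrow> bool"
  for H where
  hyp: "(p, q) \<in> H \<Longrightarrow> kat_eq H p q"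
| refl: "kat_eq H p p"
| sym: "kat_eq H p q \<Longrightarrow> kat_eq H q p"
| trans: "kat_eq H p q \<Longrightarrow> kat_eq H q r \<Longrightarrow> kat_eq H p r"
| cong_not: "is_test p \<Longrightarrow> is_test q \<Longrightarrow> kat_eq H p q \<Longrightarrow> kat_eq H (KNot p) (KNot q)"
| cong_plus: "kat_eq H p p' \<Longrightarrow> kat_eq H q q' \<Longrightarrow> kat_eq H (KPlus p q) (KPlus p' q')"
| cong_times: "kat_eq H p p' \<Longrightarrow> kat_eq H q q' \<Longrightarrow> kat_eq H (KTimes p q) (KTimes p' q')"
| cong_star: "kat_eq H p p' \<Longrightarrow> kat_eq H (KStar p) (KStar p')"
| plus_assoc: "kat_eq H (KPlus (KPlus p q) r) (KPlus p (KPlus q r))"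
| plus_comm: "kat_eq H (KPlus p q) (KPlus q p)"
| plus_zero: "kat_eq H (KPlus p KZero) p"
| plus_idem: "kat_eq H (KPlus p p) p"
| times_assoc: "kat_eq H (KTimes (KTimes p q) r) (KTimes p (KTimes q r))"
| times_one_left: "kat_eq H (KTimes KOne p) p"
| times_one_right: "kat_eq H (KTimes p KOne) p"
| times_zero_left: "kat_eq H (KTimes KZero p) KZero"
| times_zero_right: "kat_eq H (KTimes p KZero) KZero"
| distrib_left: "kat_eq H (KTimes p (KPlus q r)) (KPlus (KTimes p q) (KTimes p r))"
| distrib_right: "kat_eq H (KTimes (KPlus p q) r) (KPlus (KTimes p r) (KTimes q r))"
| star_unfold_left: "kat_eq H (KPlus KOne (KTimes p (KStar p))) (KStar p)"
| star_unfold_right: "kat_eq H (KPlus KOne (KTimes (KStar p) p)) (KStar p)"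
| star_induct_left: "kat_eq H (KPlus (KPlus q (KTimes p r)) r) r
    \<Longrightarrow> kat_eq H (KPlus (KTimes (KStar p) q) r) r"
| star_induct_right: "kat_eq H (KPlus (KPlus q (KTimes r p)) r) r
    \<Longrightarrow> kat_eq H (KPlus (KTimes q (KStar p)) r) r"
| test_comm: "is_test p \<Longrightarrow> is_test q \<Longrightarrow> kat_eq H (KTimes p q) (KTimes q p)"
| test_distrib: "is_test p \<Longrightarrow> is_test q \<Longrightarrow> is_test r
    \<Longrightarrow> kat_eq H (KPlus p (KTimes q r)) (KTimes (KPlus p q) (KPlus p r))"
| test_excluded_middle: "is_test p \<Longrightarrow> kat_eq H (KPlus p (KNot p)) KOne"
| test_contradiction: "is_test p \<Longrightarrow> kat_eq H (KTimes p (KNot p)) KZero"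

text \<open>Atomic tests are primitive boolean expressions, atomic programs are assignments.\<close>

type_synonym ('f, 'p) gcl_kat = "('p \<times> 'f iexp list, vname \<times> 'f iexp) kat"

primrec kat_bexp :: "('f, 'p) bexp \<Rightarrow> ('f, 'p) gcl_kat" where
  "kat_bexp (Prim p es) = KTest (p, es)"
| "kat_bexp (And a b) = KTimes (kat_bexp a) (kat_bexp b)"
| "kat_bexp (Or a b) = KPlus (kat_bexp a) (kat_bexp b)"
| "kat_bexp (Not a) = KNot (kat_bexp a)"

primrec kat_com :: "('f, 'p) com \<Rightarrow> ('f, 'p) gcl_kat"
  and kat_gcs :: "('f, 'p) gcs \<Rightarrow> ('f, 'p) gcl_kat" where
  "kat_com (Skip n) = KOne"
| "kat_com (Assign n x e) = KAct (x, e)"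
| "kat_com (Seq c d) = KTimes (kat_com c) (kat_com d)"
| "kat_com (If n g) = kat_gcs g"
| "kat_com (Do n g) = KTimes (KStar (kat_gcs g)) (KNot (kat_bexp (enab g)))"
| "kat_gcs (Guard e c) = KTimes (kat_bexp e) (kat_com c)"
| "kat_gcs (Alt e c g) = KPlus (KTimes (kat_bexp e) (kat_com c)) (kat_gcs g)"

definition Hyp ::
  "(('f::int_operator, 'p::int_predicate) gcl_kat \<times> ('f, 'p) gcl_kat) set" where
  "Hyp =
    {(kat_bexp e, KZero) | e. \<forall>s. \<not> bval e s} \<union>
    {(KTimes (KTimes (kat_bexp e0) (kat_com (Assign n x e))) (KNot (kat_bexp e1)), KZero)
      | e0 n x e e1. \<forall>s. bval e0 s \<longrightarrow> bval (bsubst x e e1) s}"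

definition com_equiv ::
  "('f::int_operator, 'p::int_predicate) com \<Rightarrow> ('f, 'p) com \<Rightarrow> bool" (infix "\<cong>" 50) where
  "c \<cong> d \<longleftrightarrow> kat_eq Hyp (kat_com c) (kat_com d)"


inductive rhl_plus ::
  "('f::int_operator, 'p::int_predicate) com \<Rightarrow> ('f, 'p) com \<Rightarrow> strel \<Rightarrow> strel \<Rightarrow> bool" where
  dSkip: "rhl_plus (Skip n) (Skip n') R R"
| dAsgn: "rhl_plus (Assign n x e) (Assign n' x' e') (subst_lr x x' e e' R) R"
| AsgnSkip: "rhl_plus (Assign n x e) (Skip n') (subst_l x e R) R"
| SkipAsgn: "rhl_plus (Skip n) (Assign n' x e) (subst_r x e R) R"
| dSeq: "rhl_plus c c' R Q \<Longrightarrow> rhl_plus d d' Q S \<Longrightarrow> rhl_plus (Seq c d) (Seq c' d') R S"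
| dIf: "(\<And>e c e' c'. (e, c) \<in> branches g \<Longrightarrow> (e', c') \<in> branches g'
      \<Longrightarrow> rhl_plus c c' (R \<inter> lft (bset e) \<inter> rgt (bset e')) S)
    \<Longrightarrow> rhl_plus (If n g) (If n' g') R S"
| dDo: "(\<And>e c. (e, c) \<in> branches g
      \<Longrightarrow> rhl_plus c (Skip m) (Q \<inter> lft (bset e) \<inter> \<Lambda>) Q)
    \<Longrightarrow> (\<And>e' c'. (e', c') \<in> branches g'
      \<Longrightarrow> rhl_plus (Skip m') c' (Q \<inter> rgt (bset e') \<inter> P) Q)
    \<Longrightarrow> (\<And>e c e' c'. (e, c) \<in> branches g \<Longrightarrow> (e', c') \<in> branches g'
      \<Longrightarrow> rhl_plus c c' (Q \<inter> lft (bset e) \<inter> rgt (bset e') \<inter> - \<Lambda> \<inter> - P) Q)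
    \<Longrightarrow> Q \<subseteq> beq_lr (enab g) (enab g') \<union> (\<Lambda> \<inter> lft (bset (enab g))) \<union> (P \<inter> rgt (bset (enab g')))
    \<Longrightarrow> rhl_plus (Do n g) (Do n' g') Q
          (Q \<inter> - lft (bset (enab g)) \<inter> - rgt (bset (enab g')))"
| rRewrite: "rhl_plus c c' R S \<Longrightarrow> c \<cong> d \<Longrightarrow> c' \<cong> d' \<Longrightarrow> rhl_plus d d' R S"
| rGhost: "rhl_plus c c' R S \<Longrightarrow> ghost x c \<Longrightarrow> ghost x' c' \<Longrightarrow> indep x x' R \<Longrightarrow> indep x x' S
    \<Longrightarrow> rhl_plus (erase x c) (erase x' c') R S"
| rConseq: "rhl_plus c c' R S \<Longrightarrow> R' \<subseteq> R \<Longrightarrow> S \<subseteq> S' \<Longrightarrow> rhl_plus c c' R' S'"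
| rDisj: "rhl_plus c c' Q S \<Longrightarrow> rhl_plus c c' R S \<Longrightarrow> rhl_plus c c' (Q \<union> R) S"
| rFalse: "rhl_plus c d {} R"

end

(* One-sided judgments c | skip can be derived from their weakest liberal precondition by
   induction on c: skip is equivalent both to a conditional with a valid guard and to a loop
   with an unsatisfiable guard, so that dIf and dDo apply, the latter with \<Lambda> always true.
   The rules are symmetric, so the same holds for skip | c'.  Rewriting c | c' to
   c; skip | skip; c' reduces the theorem to these two judgments. *)

theory Submission
  imports Defs
begin

text \<open>In the left unfolding of the star the product vanishes, leaving \<open>KOne\<close>.
  This collapses a loop whose guard is contradictory.\<close>

lemma kat_eq_star_zero:
  assumes "kat_eq H p KZero"
  shows "kat_eq H (KStar p) KOne"
proof -
  have "kat_eq H (KTimes p (KStar p)) KZero"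
    by (meson assms kat_eq.cong_times kat_eq.refl kat_eq.times_zero_left kat_eq.trans)
  then have "kat_eq H (KPlus KOne (KTimes p (KStar p))) KOne"
    by (meson kat_eq.cong_plus kat_eq.refl kat_eq.plus_zero kat_eq.trans)
  then show ?thesis
    by (meson kat_eq.star_unfold_left kat_eq.sym kat_eq.trans)
qed

lemma kat_eq_not_zero:
  assumes "is_test p" "kat_eq H p KZero"
  shows "kat_eq H (KNot p) KOne"
proof -
  have "kat_eq H (KPlus (KNot p) p) (KNot p)"
    by (meson assms(2) kat_eq.cong_plus kat_eq.refl kat_eq.plus_zero kat_eq.trans)
  moreover have "kat_eq H (KPlus (KNot p) p) KOne"
    by (meson assms(1) kat_eq.plus_comm kat_eq.test_excluded_middle kat_eq.trans)
  ultimately show ?thesis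
    by (meson kat_eq.sym kat_eq.trans)
qed

lemma is_test_kat_bexp: "is_test (kat_bexp b)"
  by (induction b) auto

lemma com_equiv_refl: "c \<cong> c"
  by (simp add: com_equiv_def kat_eq.refl)

lemma com_equiv_Seq_Skip_right: "Seq c (Skip n) \<cong> c"
  by (simp add: com_equiv_def kat_eq.times_one_right)

lemma com_equiv_Seq_Skip_left: "Seq (Skip n) c \<cong> c"
  by (simp add: com_equiv_def kat_eq.times_one_left)

text \<open>Expressions have no constant for truth, so excluded middle supplies the valid guard; in
  Kleene algebra it equals \<open>KOne\<close>.\<close>

lemma com_equiv_If_Skip: "If m (Guard (Or b (Not b)) (Skip k)) \<cong> Skip n"
  unfolding com_equiv_def
  by (simp, meson is_test_kat_bexp kat_eq.test_excluded_middle kat_eq.times_one_right kat_eq.trans)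

text \<open>Dually, a contradiction serves as false: the guarded body is zero, so its star is
  \<open>KOne\<close>, and so is the complement of the guard.\<close>

lemma com_equiv_Do_Skip: "Do m (Guard (And b (Not b)) (Skip k)) \<cong> Skip n"
proof -
  let ?p = "KTimes (kat_bexp b) (KNot (kat_bexp b))"
  have zero: "kat_eq Hyp ?p KZero"
    by (rule kat_eq.test_contradiction) (rule is_test_kat_bexp)
  then have "kat_eq Hyp (KTimes ?p KOne) KZero"
    by (meson kat_eq.times_one_right kat_eq.trans)
  then have "kat_eq Hyp (KStar (KTimes ?p KOne)) KOne"
    by (rule kat_eq_star_zero)
  moreover have "kat_eq Hyp (KNot ?p) KOne"
    using zero by (intro kat_eq_not_zero) (simp_all add: is_test_kat_bexp)
  ultimately show ?thesis
    unfolding com_equiv_def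
    by (simp, meson kat_eq.cong_times kat_eq.times_one_right kat_eq.trans)
qed

text \<open>The mirror image of each rule instance is again derivable, by induction on derivations:
  \<open>AsgnSkip\<close> and \<open>SkipAsgn\<close> trade places, the other rules map to
  themselves.\<close>

lemma rhl_plus_converse:
  "rhl_plus c c' R S \<Longrightarrow> rhl_plus c' c (R\<inverse>) (S\<inverse>)"
proof (induction rule: rhl_plus.induct)
  case (dSkip n n' R)
  show ?case by (rule rhl_plus.dSkip)
next
  case (dAsgn n x e n' x' e' R)
  have "(subst_lr x x' e e' R)\<inverse> = subst_lr x' x e' e (R\<inverse>)"
    by (auto simp: subst_lr_def)
  then show ?case by (simp add: rhl_plus.dAsgn)
next
  case (AsgnSkip n x e n' R)
  have "(subst_l x e R)\<inverse> = subst_r x e (R\<inverse>)"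
    by (auto simp: subst_l_def subst_r_def)
  then show ?case by (simp add: rhl_plus.SkipAsgn)
next
  case (SkipAsgn n n' x e R)
  have "(subst_r x e R)\<inverse> = subst_l x e (R\<inverse>)"
    by (auto simp: subst_l_def subst_r_def)
  then show ?case by (simp add: rhl_plus.AsgnSkip)
next
  case dSeq
  then show ?case by (blast intro: rhl_plus.dSeq)
next
  case (dIf g g' R S n n')
  show ?case
  proof (rule rhl_plus.dIf)
    fix e c e' c'
    assume "(e, c) \<in> branches g'" "(e', c') \<in> branches g"
    from dIf.IH[OF this(2,1)]
    show "rhl_plus c c' (R\<inverse> \<inter> lft (bset e) \<inter> rgt (bset e')) (S\<inverse>)"
      by (rule rhl_plus.rConseq) (auto simp: lft_def rgt_def)
  qed
next
  case (dDo g m Q \<Lambda> g' m' P n n')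
  have "rhl_plus (Do n' g') (Do n g) (Q\<inverse>)
      (Q\<inverse> \<inter> - lft (bset (enab g')) \<inter> - rgt (bset (enab g)))"
  \<comment> \<open>Swapping sides exchanges the relation licensing left-only steps with the one
    licensing right-only steps.\<close>
  proof (rule rhl_plus.dDo[where \<Lambda> = "P\<inverse>" and P = "\<Lambda>\<inverse>" and m = m' and m' = m])
    fix e c
    assume "(e, c) \<in> branches g'"
    from dDo.IH(2)[OF this]
    show "rhl_plus c (Skip m') (Q\<inverse> \<inter> lft (bset e) \<inter> P\<inverse>) (Q\<inverse>)"
      by (rule rhl_plus.rConseq) (auto simp: lft_def rgt_def)
  next
    fix e c
    assume "(e, c) \<in> branches g"
    from dDo.IH(1)[OF this]
    show "rhl_plus (Skip m) c (Q\<inverse> \<inter> rgt (bset e) \<inter> \<Lambda>\<inverse>) (Q\<inverse>)"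
      by (rule rhl_plus.rConseq) (auto simp: lft_def rgt_def)
  next
    fix e c e' c'
    assume "(e, c) \<in> branches g'" "(e', c') \<in> branches g"
    from dDo.IH(3)[OF this(2,1)]
    show "rhl_plus c c'
        (Q\<inverse> \<inter> lft (bset e) \<inter> rgt (bset e') \<inter> - P\<inverse> \<inter> - \<Lambda>\<inverse>) (Q\<inverse>)"
      by (rule rhl_plus.rConseq) (auto simp: lft_def rgt_def)
  next
    show "Q\<inverse> \<subseteq> beq_lr (enab g') (enab g) \<union> (P\<inverse> \<inter> lft (bset (enab g')))
        \<union> (\<Lambda>\<inverse> \<inter> rgt (bset (enab g)))"
      using dDo.hyps by (fastforce simp: beq_lr_def lft_def rgt_def)
  qed
  then show ?case
    by (rule rhl_plus.rConseq) (auto simp: lft_def rgt_def)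
next
  case rRewrite
  then show ?case by (blast intro: rhl_plus.rRewrite)
next
  case (rGhost c c' R S x x')
  have "indep x' x (R\<inverse>)" "indep x' x (S\<inverse>)"
    using rGhost.hyps by (auto simp: indep_def)
  then show ?case
    using rGhost by (blast intro: rhl_plus.rGhost)
next
  case (rConseq c c' R S R' S')
  from rConseq.IH show ?case
    by (rule rhl_plus.rConseq) (use rConseq.hyps in auto)
next
  case (rDisj c c' Q S R)
  then show ?case by (simp add: converse_Un rhl_plus.rDisj)
next
  case rFalse
  show ?case by (simp add: rhl_plus.rFalse)
qed

text \<open>Partial correctness makes the condition vacuous where \<open>c\<close> has no
  terminating run. The right store is only carried along.\<close>

definition wlp_left :: "('f::int_operator, 'p::int_predicate) com \<Rightarrow> strel \<Rightarrow> strel" where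
  "wlp_left c S = {(s, s'). \<forall>t. exec c s t \<longrightarrow> (t, s') \<in> S}"

lemma rhl_plus_If_Skip:
  fixes g :: "('f::int_operator, 'p::int_predicate) gcs"
  assumes "\<And>e c. (e, c) \<in> branches g \<Longrightarrow> rhl_plus c (Skip k) (R \<inter> lft (bset e)) S"
  shows "rhl_plus (If m g) (Skip n) R S"
proof -
  \<comment> \<open>Any boolean expression will do, since only \<open>Or ?b (Not ?b)\<close>
    matters; \<open>undefined\<close> merely names one.\<close>
  let ?b = "undefined :: ('f, 'p) bexp"
  have "rhl_plus (If m g) (If n (Guard (Or ?b (Not ?b)) (Skip k))) R S"
    by (rule rhl_plus.dIf) (auto intro: rhl_plus.rConseq[OF assms])
  then show ?thesis
    by (rule rhl_plus.rRewrite) (rule com_equiv_refl com_equiv_If_Skip)+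
qed

lemma rhl_plus_Do_Skip:
  fixes g :: "('f::int_operator, 'p::int_predicate) gcs"
  assumes "\<And>e c. (e, c) \<in> branches g \<Longrightarrow> rhl_plus c (Skip k) (Q \<inter> lft (bset e)) Q"
  shows "rhl_plus (Do m g) (Skip n) Q (Q \<inter> - lft (bset (enab g)))"
proof -
  let ?b = "undefined :: ('f, 'p) bexp"
  let ?h = "Guard (And ?b (Not ?b)) (Skip k)"
  \<comment> \<open>Discharges the premises of \<open>dDo\<close> for right-only and joint steps,
    whose preconditions are empty under the choice of \<Lambda> and \<open>P\<close> below.\<close>
  have empty: "rhl_plus c c' R S" if "R = {}" for c c' :: "('f, 'p) com" and R S
    using that by (simp add: rhl_plus.rFalse)
  have "rhl_plus (Do m g) (Do n ?h) Q
      (Q \<inter> - lft (bset (enab g)) \<inter> - rgt (bset (enab ?h)))"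
  \<comment> \<open>Every iteration is a left-only step. The side condition holds: if
    \<open>enab g\<close> is true on the left, the \<Lambda> disjunct applies; otherwise both guards
    are false and agree.\<close>
  proof (rule rhl_plus.dDo[where \<Lambda> = UNIV and P = "{}" and m = k and m' = k])
    show "rhl_plus c (Skip k) (Q \<inter> lft (bset e) \<inter> UNIV) Q"
      if "(e, c) \<in> branches g" for e c
      using assms[OF that] by simp
  qed (auto intro: empty simp: beq_lr_def lft_def bset_def)
  then have "rhl_plus (Do m g) (Skip n) Q
      (Q \<inter> - lft (bset (enab g)) \<inter> - rgt (bset (enab ?h)))"
    by (rule rhl_plus.rRewrite) (rule com_equiv_refl com_equiv_Do_Skip)+
  then show ?thesis
    by (rule rhl_plus.rConseq) auto
qed

lemma rhl_plus_wlp_left: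
  fixes c :: "('f::int_operator, 'p::int_predicate) com"
  shows "rhl_plus c (Skip n) (wlp_left c S) S"
proof -
  \<comment> \<open>\<open>S\<close> is general because a sequence uses the hypothesis for
    \<open>c\<close> at \<open>wlp_left d S\<close>, and a loop uses that for its body at the loop
    invariant. The second claim carries the induction through guarded commands.\<close>
  have "\<forall>S n. rhl_plus c (Skip n) (wlp_left c S) S"
    and "\<forall>e c S n. (e, c) \<in> branches g \<longrightarrow> rhl_plus c (Skip n) (wlp_left c S) S"
    for g :: "('f, 'p) gcs"
  proof (induction c and g rule: com.induct gcs.induct)
    case (Skip m)
    show ?case
      by (intro allI rhl_plus.rConseq[OF rhl_plus.dSkip _ subset_refl])
        (auto simp: wlp_left_def intro: exec.Skip)
  next
    case (Assign m x e)
    show ?case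
      by (intro allI rhl_plus.rConseq[OF rhl_plus.AsgnSkip _ subset_refl])
        (auto simp: wlp_left_def subst_l_def intro: exec.Assign)
  next
    case (Seq c d)
    show ?case
    proof (intro allI)
      fix S n
      have "rhl_plus (Seq c d) (Seq (Skip n) (Skip n)) (wlp_left c (wlp_left d S)) S"
        using Seq by (blast intro: rhl_plus.dSeq)
      then have "rhl_plus (Seq c d) (Skip n) (wlp_left c (wlp_left d S)) S"
        by (rule rhl_plus.rRewrite) (rule com_equiv_refl com_equiv_Seq_Skip_left)+
      then show "rhl_plus (Seq c d) (Skip n) (wlp_left (Seq c d) S) S"
        by (rule rhl_plus.rConseq) (auto simp: wlp_left_def intro: exec.Seq)
    qed
  next
    case (If m g)
    show ?case
    proof (intro allI rhl_plus_If_Skip)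
      fix S n e c
      assume br: "(e, c) \<in> branches g"
      then have "rhl_plus c (Skip n) (wlp_left c S) S"
        using If by blast
      then show "rhl_plus c (Skip n) (wlp_left (If m g) S \<inter> lft (bset e)) S"
        by (rule rhl_plus.rConseq)
          (auto simp: wlp_left_def lft_def bset_def intro: exec.If[OF br])
    qed
  next
    case (Do m g)
    show ?case
    proof (intro allI)
      fix S n
      \<comment> \<open>The precondition of the loop is its own invariant: an iteration followed by
        a run of the loop is a run of the loop. On exit the empty run yields
        \<open>S\<close>.\<close>
      let ?Q = "wlp_left (Do m g) S"
      have "rhl_plus (Do m g) (Skip n) ?Q (?Q \<inter> - lft (bset (enab g)))"
      proof (rule rhl_plus_Do_Skip)
        fix e c
        assume br: "(e, c) \<in> branches g"
        then have "rhl_plus c (Skip n) (wlp_left c ?Q) ?Q"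
          using Do by blast
        then show "rhl_plus c (Skip n) (?Q \<inter> lft (bset e)) ?Q"
          by (rule rhl_plus.rConseq)
            (auto simp: wlp_left_def lft_def bset_def intro: exec.Do_iter[OF br])
      qed
      then show "rhl_plus (Do m g) (Skip n) ?Q S"
        by (rule rhl_plus.rConseq)
          (auto simp: wlp_left_def lft_def bset_def intro: exec.Do_exit)
    qed
  qed auto
  then show ?thesis by blast
qed

lemma rhl_plus_wlp_right: "rhl_plus (Skip n) c ((wlp_left c (S\<inverse>))\<inverse>) S"
  using rhl_plus_converse[OF rhl_plus_wlp_left[of c n "S\<inverse>"]] by simp

theorem theorem8p2:
  fixes c c' :: "('f::int_operator, 'p::int_predicate) com"
    and S T :: "(store \<times> store) set"
  assumes "wf_com c" and "wf_com c'"
    and "rvalid c c' S T"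
  shows "rhl_plus c c' S T"
proof -
  \<comment> \<open>The intermediate relation, after \<open>c\<close> has finished and before
    \<open>c'\<close> starts. Validity says exactly that \<open>S\<close> is contained in
    \<open>wlp_left c ?Q\<close>.\<close>
  let ?Q = "(wlp_left c' (T\<inverse>))\<inverse>"
  have "rhl_plus (Seq c (Skip 0)) (Seq (Skip 0) c') (wlp_left c ?Q) T"
    by (rule rhl_plus.dSeq[OF rhl_plus_wlp_left rhl_plus_wlp_right])
  then have "rhl_plus c c' (wlp_left c ?Q) T"
    by (rule rhl_plus.rRewrite) (rule com_equiv_Seq_Skip_right com_equiv_Seq_Skip_left)+
  then show ?thesis
    by (rule rhl_plus.rConseq)
      (use assms(3) in \<open>auto simp: rvalid_def den_def wlp_left_def\<close>)
qed

end
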